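(* Let $k\ge 1$, let $O=(0,\dots,0)\in\mathbb{R}^{k+1}$, $S^k=\{x\in\mathbb{R}^{k+1}\mid \|x\|=1\}$ and $A=e=(1,0,\dots,0)\in S^k$. Let $X=x,\ Y=y\in S^k\setminus\{\pm e\}$. Let $U$ (resp. $V$) be the unit vector along the bisector of the angle $\angle AOX$ (resp. $\angle AOY$), lying in the plane of the triangle $AOX$ (resp. $AOY$). Let $\mathbb{T}=\{1\}\times\mathbb{R}^k\subseteq\mathbb{R}^{k+1}$ be the tangent hyperplane to $S^k$ at $A$, and let $B$ (resp. $C$) be the point where the ray from $O$ in direction $U$ (resp. $V$) meets $\mathbb{T}$. Suppose that $\angle AOX,\ \angle AOY\in 4\mathbb{Q}_{tan}$. Then the following are equivalent: (1) $\|x-y\|$ is rational; (2) $\sin\!\big(\tfrac{\angle XOY}{2}\big)$ is rational; (3) the side length $BC$ of the triangle $ABC$ is rational; (4) the set $\{A,B,C\}$ is a rational set, i.e. all pairwise Euclidean distances among $A,B,C$ are rational.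
   Context: $\mathbb{Q}_{tan}=\{\theta\in\mathbb{R}\mid \tan\theta\in\mathbb{Q}\ \text{or}\ \theta=(2m+1)\pi/2 \text{ for some } m\in\mathbb{Z}\}$, and $4\mathbb{Q}_{tan}=\{4\theta\mid\theta\in\mathbb{Q}_{tan}\}$. (Equivalently, $4\mathbb{Q}_{tan}$ is the set of $\theta$ with $\tan\theta=\frac{2pq}{p^2-q^2}$ for some integers $p,q$ with $\gcd(p,q)=1$ and $p^2+q^2$ a perfect square.) Angles $\angle AOX$ etc. are the usual angles in $[0,\pi]$ between the vectors. *)

theory Defs
  imports "HOL-Analysis.Analysis"
begin

text \<open>
  The space \<open>\<real>\<^sup>k\<^sup>+\<^sup>1\<close> is represented by the product \<open>real \<times> (real ^ 'k)\<close> with \<open>k = CARD('k) \<ge> 1\<close>,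
  so that the first coordinate is the first component and \<open>{1} \<times> \<real>\<^sup>k\<close> can be written literally.
  The library norm on products is \<open>sqrt (norm a ^ 2 + norm b ^ 2)\<close>, so this is the
  Euclidean norm on \<open>\<real>\<^sup>k\<^sup>+\<^sup>1\<close>.
\<close>

definition Qtan :: "real set" where
  "Qtan = {\<theta>. tan \<theta> \<in> \<rat> \<or> (\<exists>m::int. \<theta> = (2 * of_int m + 1) * pi / 2)}"

definition fourQtan :: "real set" where
  "fourQtan = (\<lambda>\<theta>. 4 * \<theta>) ` Qtan"

text \<open>The angle \<open>PQR\<close> at the vertex \<open>Q\<close>, in \<open>[0, pi]\<close>; meaningful for \<open>P \<noteq> Q\<close> and \<open>R \<noteq> Q\<close>.\<close>

definition angle :: "'a::real_inner \<Rightarrow> 'a \<Rightarrow> 'a \<Rightarrow> real" where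
  "angle P Q R = arccos (((P - Q) \<bullet> (R - Q)) / (norm (P - Q) * norm (R - Q)))"

text \<open>
  \<open>W\<close> is the unit vector along the (internal) bisector of the angle \<open>PQR\<close>, in the plane of the
  triangle \<open>PQR\<close>. Requiring both half-angles to be half of \<open>PQR\<close>, rather than just equal, excludes
  the vector opposite to the bisector.
\<close>

definition is_unit_bisector :: "'a::real_inner \<Rightarrow> 'a \<Rightarrow> 'a \<Rightarrow> 'a \<Rightarrow> bool" where
  "is_unit_bisector P Q R W \<longleftrightarrow>
     norm W = 1 \<and> W \<in> span {P - Q, R - Q} \<and>
     angle P Q (Q + W) = angle P Q R / 2 \<and> angle (Q + W) Q R = angle P Q R / 2"

definition ray :: "'a::real_vector \<Rightarrow> 'a \<Rightarrow> 'a set" where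
  "ray P W = {P + t *\<^sub>R W | t. t \<ge> 0}"

definition rational_set :: "'a::metric_space set \<Rightarrow> bool" where
  "rational_set S \<longleftrightarrow> (\<forall>P\<in>S. \<forall>Q\<in>S. dist P Q \<in> \<rat>)"

end

theory Submission
  imports Defs
begin

text \<open>
  The bisector of the angle \<open>AOX\<close> has the direction of \<open>A + X\<close>, so \<open>B = (2 / \<parallel>A + X\<parallel>\<^sup>2) (A + X)\<close> is the
  image of \<open>X\<close> under an inversion centred at \<open>-A\<close> that fixes \<open>A\<close>. Hence
  \<open>BC = 2 \<parallel>X - Y\<parallel> / (\<parallel>A + X\<parallel> \<parallel>A + Y\<parallel>)\<close> and \<open>AB = \<parallel>A - X\<parallel> / \<parallel>A + X\<parallel>\<close>. If \<open>\<angle>AOX = 4 \<theta>\<close> with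
  \<open>tan \<theta>\<close> rational, then \<open>\<parallel>A + X\<parallel> = 2 cos (2 \<theta>)\<close> and \<open>\<parallel>A - X\<parallel> = 2 sin (2 \<theta>)\<close> are rational.
  Finally \<open>\<parallel>X - Y\<parallel> = 2 sin (\<angle>XOY / 2)\<close>.
\<close>

text \<open>Both values are rational functions of \<open>tan \<theta>\<close>; at odd multiples of
  \<open>pi / 2\<close>, where the tangent gives no information, they are -1 and 0.\<close>

lemma Qtan_double_angle_Rats:
  assumes "\<theta> \<in> Qtan"
  shows "cos (2 * \<theta>) \<in> \<rat>" and "sin (2 * \<theta>) \<in> \<rat>"
proof -
  have "cos (2 * \<theta>) \<in> \<rat> \<and> sin (2 * \<theta>) \<in> \<rat>"
  proof (cases "cos \<theta> = 0")
    case True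
    then show ?thesis by (simp add: cos_double_cos sin_double)
  next
    case False
    have "tan \<theta> \<in> \<rat>"
    proof -
      have "\<theta> \<noteq> (2 * of_int m + 1) * pi / 2" for m :: int
      proof
        assume "\<theta> = (2 * of_int m + 1) * pi / 2"
        then have "\<theta> = of_int (2 * m + 1) * (pi / 2)" by simp
        moreover have "odd (2 * m + 1)" by simp
        ultimately show False
          using False unfolding cos_zero_iff_int by blast
      qed
      with assms show ?thesis by (auto simp: Qtan_def)
    qed
    moreover have "(cos \<theta>)\<^sup>2 = 1 / (1 + (tan \<theta>)\<^sup>2)"
      using tan_sec[OF False] by (simp add: field_simps)
    ultimately have "(cos \<theta>)\<^sup>2 \<in> \<rat>" by simp
    moreover have "sin (2 * \<theta>) = 2 * tan \<theta> * (cos \<theta>)\<^sup>2"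
      using False by (simp add: sin_double tan_def power2_eq_square)
    ultimately show ?thesis
      using \<open>tan \<theta> \<in> \<rat>\<close> by (simp add: cos_double_cos)
  qed
  then show "cos (2 * \<theta>) \<in> \<rat>" "sin (2 * \<theta>) \<in> \<rat>" by auto
qed

text \<open>Cauchy-Schwarz keeps the argument of \<open>arccos\<close> in [-1, 1]. A side of length
  zero turns the quotient into 0, since division by zero yields 0.\<close>

lemma cos_angle:
  fixes P Q R :: "'a::real_inner"
  shows "cos (angle P Q R) = ((P - Q) \<bullet> (R - Q)) / (norm (P - Q) * norm (R - Q))"
proof -
  have "\<bar>((P - Q) \<bullet> (R - Q)) / (norm (P - Q) * norm (R - Q))\<bar> \<le> 1"
    using Cauchy_Schwarz_ineq2[of "P - Q" "R - Q"]
    by (auto simp: abs_mult divide_le_eq_1 zero_less_mult_iff)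
  then show ?thesis
    unfolding angle_def by (intro cos_arccos_abs)
qed

lemma angle_bounds: "0 \<le> angle P Q R" "angle P Q R \<le> pi"
proof -
  have "\<bar>((P - Q) \<bullet> (R - Q)) / (norm (P - Q) * norm (R - Q))\<bar> \<le> 1"
    unfolding cos_angle[symmetric] by simp
  then have "- 1 \<le> ((P - Q) \<bullet> (R - Q)) / (norm (P - Q) * norm (R - Q))"
    "((P - Q) \<bullet> (R - Q)) / (norm (P - Q) * norm (R - Q)) \<le> 1"
    by linarith+
  then show "0 \<le> angle P Q R" "angle P Q R \<le> pi"
    unfolding angle_def by (auto intro!: arccos_lbound arccos_ubound)
qed

lemma norm_add_eq_cos_half_angle:
  fixes P Q :: "'a::real_inner"
  assumes "norm P = 1" "norm Q = 1"
  shows "norm (P + Q) = 2 * cos (angle P 0 Q / 2)"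
proof (rule power2_eq_imp_eq)
  have "(norm (P + Q))\<^sup>2 = 2 + 2 * cos (angle P 0 Q)"
    using assms assms[unfolded norm_eq_1]
    by (simp add: cos_angle power2_norm_eq_inner inner_add inner_commute)
  also have "\<dots> = (2 * cos (angle P 0 Q / 2))\<^sup>2"
    using cos_double_cos[of "angle P 0 Q / 2"] by (simp add: power2_eq_square)
  finally show "(norm (P + Q))\<^sup>2 = (2 * cos (angle P 0 Q / 2))\<^sup>2" .
  \<comment> \<open>The half angle lies in [0, pi/2], which fixes the sign of the square
    root.\<close>
  show "0 \<le> 2 * cos (angle P 0 Q / 2)"
    using angle_bounds[of P 0 Q] by (simp add: cos_ge_zero)
qed simp

lemma norm_diff_eq_sin_half_angle:
  fixes P Q :: "'a::real_inner"
  assumes "norm P = 1" "norm Q = 1"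
  shows "norm (P - Q) = 2 * sin (angle P 0 Q / 2)"
proof (rule power2_eq_imp_eq)
  have "(norm (P - Q))\<^sup>2 = 2 - 2 * cos (angle P 0 Q)"
    using assms assms[unfolded norm_eq_1]
    by (simp add: cos_angle power2_norm_eq_inner inner_diff inner_commute)
  also have "\<dots> = (2 * sin (angle P 0 Q / 2))\<^sup>2"
    using cos_double_sin[of "angle P 0 Q / 2"] by (simp add: power2_eq_square)
  finally show "(norm (P - Q))\<^sup>2 = (2 * sin (angle P 0 Q / 2))\<^sup>2" .
  show "0 \<le> 2 * sin (angle P 0 Q / 2)"
    using angle_bounds[of P 0 Q] by (simp add: sin_ge_zero)
qed simp

text \<open>The difference \<open>D\<close> of the two sides lies in the span of \<open>P\<close>
  and \<open>R\<close>, and the two half-angle conditions make it orthogonal to both. So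
  \<open>D\<close> is orthogonal to itself and vanishes.\<close>

lemma unit_bisector_eq:
  fixes P R W :: "'a::real_inner"
  assumes "norm P = 1" "norm R = 1" "P + R \<noteq> 0" and W: "is_unit_bisector P 0 R W"
  shows "W = (1 / norm (P + R)) *\<^sub>R (P + R)"
proof -
  define n where "n = norm (P + R)"
  define D where "D = W - (1 / n) *\<^sub>R (P + R)"
  have n: "n \<noteq> 0" "n\<^sup>2 = 2 * (1 + P \<bullet> R)"
    using assms
    by (simp_all add: n_def power2_norm_eq_inner inner_add norm_eq_1 inner_commute)
  have "n = 2 * cos (angle P 0 R / 2)"
    unfolding n_def using assms by (intro norm_add_eq_cos_half_angle)
  moreover have half: "norm W = 1" "angle P 0 W = angle P 0 R / 2" "angle W 0 R = angle P 0 R / 2"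
    using W by (simp_all add: is_unit_bisector_def)
  ultimately have "P \<bullet> W = n / 2" "W \<bullet> R = n / 2"
    using cos_angle[of P 0 W, unfolded half(2)] cos_angle[of W 0 R, unfolded half(3)] assms(1,2)
    by simp_all
  \<comment> \<open>The left side is the inner product of the normalised \<open>P + R\<close> with
    either unit vector \<open>P\<close> or \<open>R\<close>.\<close>
  moreover have mid: "(1 + P \<bullet> R) / n = n / 2"
    using n by (simp add: field_simps power2_eq_square)
  ultimately have "P \<bullet> W = (1 + P \<bullet> R) / n" "W \<bullet> R = (1 + P \<bullet> R) / n"
    unfolding mid by simp_all
  then have "orthogonal D P" "orthogonal D R"
    using assms(1,2)
    by (simp_all add: D_def orthogonal_def inner_diff inner_add norm_eq_1 inner_commute add.commute)
  moreover have "D \<in> span {P, R}"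
    using W unfolding D_def is_unit_bisector_def
    by (auto intro!: span_diff span_scale span_add intro: span_base)
  ultimately have "orthogonal D D"
    by (intro orthogonal_to_span[of D "{P, R}"]) auto
  then show ?thesis
    by (simp add: orthogonal_def D_def n_def)
qed

text \<open>How inversion in the unit sphere changes distances; after squaring, both sides expand to
  the same expression in inner products.\<close>

lemma norm_diff_inversion:
  fixes p q :: "'a::real_inner"
  assumes "p \<noteq> 0" "q \<noteq> 0"
  shows "norm ((1 / (norm p)\<^sup>2) *\<^sub>R p - (1 / (norm q)\<^sup>2) *\<^sub>R q) = norm (p - q) / (norm p * norm q)"
proof (rule power2_eq_imp_eq)
  have "p \<bullet> p \<noteq> 0" "q \<bullet> q \<noteq> 0"
    using assms by auto
  then show "(norm ((1 / (norm p)\<^sup>2) *\<^sub>R p - (1 / (norm q)\<^sup>2) *\<^sub>R q))\<^sup>2 = (norm (p - q) / (norm p * norm q))\<^sup>2"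
    by (simp add: power_divide power_mult_distrib power2_norm_eq_inner inner_diff inner_commute)
      (simp add: field_simps)
qed auto

text \<open>Translation by \<open>A\<close> followed by inversion in the sphere of radius sqrt 2
  about the origin. For a unit vector \<open>A\<close>, the translated unit sphere passes through
  the origin, so its other points go to the tangent hyperplane at \<open>A\<close>.\<close>

definition tangent_point :: "'a::real_inner \<Rightarrow> 'a \<Rightarrow> 'a" where
  "tangent_point A X = (2 / (norm (A + X))\<^sup>2) *\<^sub>R (A + X)"

lemma tangent_point_self:
  assumes "norm A = 1"
  shows "tangent_point A A = A"
proof -
  have "A + A = 2 *\<^sub>R A" by (simp add: scaleR_2)
  then show ?thesis using assms by (simp add: tangent_point_def)
qed

lemma dist_tangent_point:
  fixes A X Y :: "'a::real_inner"
  assumes "A + X \<noteq> 0" "A + Y \<noteq> 0"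
  shows "dist (tangent_point A X) (tangent_point A Y) =
    2 * norm (X - Y) / (norm (A + X) * norm (A + Y))"
proof -
  have "tangent_point A X - tangent_point A Y =
      2 *\<^sub>R ((1 / (norm (A + X))\<^sup>2) *\<^sub>R (A + X) - (1 / (norm (A + Y))\<^sup>2) *\<^sub>R (A + Y))"
    by (simp add: tangent_point_def scaleR_diff_right)
  then show ?thesis
    using norm_diff_inversion[OF assms] by (simp add: dist_norm)
qed

text \<open>The condition \<open>A \<bullet> B = 1\<close> is the tangent hyperplane without
  coordinates. It determines the multiple of \<open>A + X\<close> on the ray.\<close>

lemma bisector_ray_meets_tangent:
  fixes A X U B :: "'a::real_inner"
  assumes "norm A = 1" "norm X = 1" "A + X \<noteq> 0"
    and "is_unit_bisector A 0 X U" and "B \<in> ray 0 U" and "A \<bullet> B = 1"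
  shows "B = tangent_point A X"
proof -
  define n where "n = norm (A + X)"
  have n: "n \<noteq> 0" "n\<^sup>2 = 2 * (1 + A \<bullet> X)"
    using assms(1-3)
    by (simp_all add: n_def power2_norm_eq_inner inner_add norm_eq_1 inner_commute)
  obtain s where s: "B = s *\<^sub>R (A + X)"
    using \<open>B \<in> ray 0 U\<close> unit_bisector_eq[OF assms(1-4)] by (auto simp: ray_def)
  then have "s * (1 + A \<bullet> X) = 1"
    using assms(1,6) by (simp add: inner_add_right norm_eq_1)
  then have "s * n\<^sup>2 = 2"
    using n(2) by (simp add: algebra_simps)
  then have "s = 2 / n\<^sup>2"
    using n(1) by (simp add: eq_divide_eq)
  then show ?thesis
    using s by (simp add: tangent_point_def n_def)
qed

text \<open>The factor 4 in \<open>fourQtan\<close> makes the half angle equal to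
  \<open>2 * \<theta>\<close>, whose sine and cosine are rational.\<close>

lemma fourQtan_norm_Rats:
  fixes P Q :: "'a::real_inner"
  assumes "norm P = 1" "norm Q = 1" "angle P 0 Q \<in> fourQtan"
  shows "norm (P + Q) \<in> \<rat>" and "norm (P - Q) \<in> \<rat>"
proof -
  obtain \<theta> where "\<theta> \<in> Qtan" "angle P 0 Q / 2 = 2 * \<theta>"
    using assms(3) by (auto simp: fourQtan_def)
  then show "norm (P + Q) \<in> \<rat>" "norm (P - Q) \<in> \<rat>"
    using norm_add_eq_cos_half_angle[OF assms(1,2)] norm_diff_eq_sin_half_angle[OF assms(1,2)]
      Qtan_double_angle_Rats[of \<theta>] by simp_all
qed

lemma Rats_mult_cancel_left:
  fixes a b :: "'a::field_char_0"
  assumes "a \<in> \<rat>" "a \<noteq> 0"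
  shows "a * b \<in> \<rat> \<longleftrightarrow> b \<in> \<rat>"
  using assms Rats_divide[of "a * b" a] by auto

theorem theorem3p3:
  fixes A X Y U V B C :: "real \<times> (real ^ 'k)"
    and T :: "(real \<times> (real ^ 'k)) set"
  assumes A: "A = (1, 0)"
    and T: "T = {1} \<times> UNIV"
    and X: "X \<in> sphere 0 1 - {A, - A}"
    and Y: "Y \<in> sphere 0 1 - {A, - A}"
    and U: "is_unit_bisector A 0 X U"
    and V: "is_unit_bisector A 0 Y V"
    and B: "ray 0 U \<inter> T = {B}"
    and C: "ray 0 V \<inter> T = {C}"
    and AOX: "angle A 0 X \<in> fourQtan"
    and AOY: "angle A 0 Y \<in> fourQtan"
  shows "(norm (X - Y) \<in> \<rat> \<longleftrightarrow> sin (angle X 0 Y / 2) \<in> \<rat>) \<and>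
         (sin (angle X 0 Y / 2) \<in> \<rat> \<longleftrightarrow> dist B C \<in> \<rat>) \<and>
         (dist B C \<in> \<rat> \<longleftrightarrow> rational_set {A, B, C})"
proof -
  have unit: "norm A = 1" "norm X = 1" "norm Y = 1"
    using A X Y by simp_all
  have "A \<noteq> 0"
    using unit by auto
  then have nz: "A + A \<noteq> 0" "A + X \<noteq> 0" "A + Y \<noteq> 0"
    using X Y by (auto simp: add_eq_0_iff simp flip: scaleR_2)
  have BT: "B \<in> ray 0 U" "A \<bullet> B = 1" and CT: "C \<in> ray 0 V" "A \<bullet> C = 1"
  proof -
    have "B \<in> ray 0 U \<inter> T" "C \<in> ray 0 V \<inter> T"
      using B C by simp_all
    then show "B \<in> ray 0 U" "A \<bullet> B = 1" "C \<in> ray 0 V" "A \<bullet> C = 1"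
      using A T by auto
  qed
  have B': "B = tangent_point A X" and C': "C = tangent_point A Y"
    using bisector_ray_meets_tangent unit nz U V BT CT by blast+
  \<comment> \<open>With \<open>A\<close> as a value of the same map, the distance formula for
    \<open>B\<close> and \<open>C\<close> also yields AB and AC.\<close>
  have A': "A = tangent_point A A"
    using tangent_point_self unit by metis
  note rats = fourQtan_norm_Rats[OF unit(1,2) AOX] fourQtan_norm_Rats[OF unit(1,3) AOY]
  have normAA: "norm (A + A) = 2"
    using unit by (simp add: scaleR_2[symmetric])
  have "dist A B \<in> \<rat>" "dist A C \<in> \<rat>"
    using dist_tangent_point[OF nz(1,2)] dist_tangent_point[OF nz(1,3)] rats
    by (simp_all add: A'[symmetric] B'[symmetric] C'[symmetric] normAA)
  then have "rational_set {A, B, C} \<longleftrightarrow> dist B C \<in> \<rat>"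
    by (auto simp: rational_set_def dist_commute)
  moreover have "norm (X - Y) \<in> \<rat> \<longleftrightarrow> sin (angle X 0 Y / 2) \<in> \<rat>"
    unfolding norm_diff_eq_sin_half_angle[OF unit(2,3)] by (rule Rats_mult_cancel_left) auto
  moreover have "dist B C \<in> \<rat> \<longleftrightarrow> norm (X - Y) \<in> \<rat>"
  proof -
    \<comment> \<open>The two distances differ by a nonzero rational factor.\<close>
    have "dist B C = 2 / (norm (A + X) * norm (A + Y)) * norm (X - Y)"
      unfolding B' C' dist_tangent_point[OF nz(2,3)] by simp
    moreover have "2 / (norm (A + X) * norm (A + Y)) \<in> \<rat>"
      using rats by simp
    moreover have "2 / (norm (A + X) * norm (A + Y)) \<noteq> 0"
      using nz by simp
    ultimately show ?thesis
      using Rats_mult_cancel_left by metis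
  qed
  ultimately show ?thesis by blast
qed

end
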